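(* (i) Let $n$ be a positive integer, $w=(w_1,\dots,w_n)$ an $n$-tuple of positive integers, and $r\in\mathbb N$. Then, in $\mathbb Q[[t]]$, \[\frac{\prod_{i=1}^r(1-t^i)}{\prod_{i=1}^n(1-t^{w_i})}=\sum_{m\in\mathbb N}\Big(\sum_{T\subseteq[r]}(-1)^{|T|}D_w(m-\omega(T))\Big)t^m.\] (ii) Let $n$ be a positive integer and $d:d_1<\cdots<d_r$ positive integers with $d_r<n$. For all $k\in\mathbb N$, \[I_n(d;k)=\sum_{T\subseteq[n]}(-1)^{|T|}D_{\varepsilon(d,n)}(k-\omega(T))=\sum_{i=0}^k\psi_n(i)D_{\varepsilon(d,n)}(k-i).\] (iii) For all $k\in\mathbb N$, \[I_n(k)=\sum_{T\subseteq[n]}(-1)^{|T|}\binom{n-1+k-\omega(T)}{n-1}=\sum_{i=0}^k\psi_n(i)\binom{n-1+k-i}{n-1}.\] (iv) Let $d^*$ be a refinement of $d$ and for $1\le i\le r+1$ let $d[i]^*$ be the (possibly empty) sequence obtained by listing the members $x$ of $d^*$ with $d_{i-1}<x<d_i$ and replacing each by $x-d_{i-1}$ (a sequence of positive integers $<e_i$). Let $\mathcal A_m:=\{(j_1,\dots,j_{r+1})\in\mathbb N^{r+1}: j_1+\cdots+j_{r+1}=m\}$. Then for all $k\in\mathbb N$, \[I_n(d;k)=I_n(d^*;k)-\sum_{m=1}^k\Big(\sum_{(j_1,\dots,j_{r+1})\in\mathcal A_m}\prod_{i=1}^{r+1}I_{e_i}(d[i]^*;j_i)\Big)I_n(d;k-m).\]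 In particular $I_n(d;k)\le I_n(d^*;k)$. (v) Let $\nu(d):=\sum_{1\le i<j\le r+1}e_ie_j$. Then $\nu(d)\le n(n-1)/2$, $I_n(d;k)=I_n(d;\nu(d)-k)$ for all $k\in\mathbb N$, and $I_n(d;k)\ge1$ for $0\le k\le\nu(d)$.
   Context: $[n]=\{1,\dots,n\}$, $[0]=\emptyset$. For a tuple $w$ of positive integers, $D_w(m)$ ($m\in\mathbb Z$) is defined by $\prod_{i=1}^n(1-t^{w_i})^{-1}=\sum_{m}D_w(m)t^m$; so $D_w(m)=0$ for $m<0$ and $D_w(m)$ is the number of $(i_1,\dots,i_n)\in\mathbb N^n$ with $\sum i_jw_j=m$. For $T\subseteq[n]$, $\omega(T):=\sum_{i\in T}i$; $\psi_n(r):=\sum_{T\subseteq[n],\,\omega(T)=r}(-1)^{|T|}$. For $a,b\in\mathbb Z$, $\binom ab:=0$ if $\min\{a,b\}<0$ or $a<b$, and $\binom ab=\prod_{i=0}^{b-1}\frac{a-i}{i+1}$ if $0\le b\le a$. For $d:d_1<\cdots<d_r$ with $d_r<n$ put $d_0:=0$, $d_{r+1}:=n$, $e_i:=d_i-d_{i-1}$ ($1\le i\le r+1$); $d$ may be the empty sequence ($r=0$). $\varepsilon(d,n):=(w_1,\dots,w_n)$ with $w_i=i-d_j$ whenever $d_j<i\le d_{j+1}$. $I_n(d;k)$ is the number of words of length $n$ in which each letter $i\in[r+1]$ occurs exactly $e_i$ times having exactly $k$ inversions (pairs of positions $p<p'$ with the letter at $p$ larger than that at $p'$). $I_n(k):=I_n(d;k)$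 for $d:1<2<\cdots<n-1$, i.e. the number of permutations of $[n]$ with exactly $k$ inversions. A refinement of $d$ is a sequence $d^*:d^*_1<\cdots<d^*_s<n$ of positive integers containing every $d_i$. *)

theory Defs
  imports "HOL-Computational_Algebra.Formal_Power_Series"
begin

definition denum :: "nat list \<Rightarrow> int \<Rightarrow> rat" where
  "denum w m =
     (if m < 0 then 0
      else fps_nth (\<Prod>i<length w. inverse (1 - fps_X ^ (w ! i))) (nat m))"

definition omega :: "nat set \<Rightarrow> nat" where
  "omega T = (\<Sum>i\<in>T. i)"

definition psi :: "nat \<Rightarrow> nat \<Rightarrow> int" where
  "psi n r = (\<Sum>T | T \<subseteq> {1..n} \<and> omega T = r. (-1) ^ card T)"

(* Unlike gchoose, this binomial coefficient vanishes when an argument is negative. *)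
definition binom :: "int \<Rightarrow> int \<Rightarrow> rat" where
  "binom a b =
     (if min a b < 0 \<or> a < b then 0
      else (\<Prod>i<nat b. (of_int a - of_nat i) / (of_nat i + 1)))"

(* The list [d_1, ..., d_r]; the empty list is the case r = 0. *)
definition dim_seq :: "nat \<Rightarrow> nat list \<Rightarrow> bool" where
  "dim_seq n d \<longleftrightarrow> sorted_wrt (<) d \<and> set d \<subseteq> {0<..<n}"

(* dd n d i is d_i for 0 \<le> i \<le> r + 1, where d_0 = 0 and d_{r+1} = n. *)
definition dd :: "nat \<Rightarrow> nat list \<Rightarrow> nat \<Rightarrow> nat" where
  "dd n d i = (0 # d @ [n]) ! i"

(* Used only for 1 \<le> i \<le> r + 1. *)
definition ee :: "nat \<Rightarrow> nat list \<Rightarrow> nat \<Rightarrow> nat" where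
  "ee n d i = dd n d i - dd n d (i - 1)"

definition eps :: "nat list \<Rightarrow> nat \<Rightarrow> nat list" where
  "eps d n =
     map (\<lambda>i. i - dd n d (THE j. j \<le> length d \<and> dd n d j < i \<and> i \<le> dd n d (j + 1)))
       [1..<n + 1]"

definition inversions :: "nat list \<Rightarrow> nat" where
  "inversions u = card {(p, p'). p < p' \<and> p' < length u \<and> u ! p > u ! p'}"

definition words :: "nat \<Rightarrow> nat list \<Rightarrow> nat list set" where
  "words n d =
     {u. length u = n \<and> set u \<subseteq> {1..length d + 1} \<and>
         (\<forall>i\<in>{1..length d + 1}. count_list u i = ee n d i)}"

(* The number of inversions is an integer so that negative values (count 0) make sense. *)
definition inv_words :: "nat \<Rightarrow> nat list \<Rightarrow> int \<Rightarrow> nat" where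
  "inv_words n d k = card {u \<in> words n d. int (inversions u) = k}"

definition inv_perms :: "nat \<Rightarrow> int \<Rightarrow> nat" where
  "inv_perms n k = inv_words n [1..<n] k"

definition refinement :: "nat \<Rightarrow> nat list \<Rightarrow> nat list \<Rightarrow> bool" where
  "refinement n d ds \<longleftrightarrow> dim_seq n ds \<and> set d \<subseteq> set ds"

(* The sequence d[i]^*, where ds is d^*. *)
definition block :: "nat \<Rightarrow> nat list \<Rightarrow> nat list \<Rightarrow> nat \<Rightarrow> nat list" where
  "block n d ds i =
     map (\<lambda>x. x - dd n d (i - 1)) (filter (\<lambda>x. dd n d (i - 1) < x \<and> x < dd n d i) ds)"

(* The tuples of \<A>_m of length l; the entry j_i is js ! (i - 1). *)
definition tuples :: "nat \<Rightarrow> nat \<Rightarrow> nat list set" where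
  "tuples l m = {js. length js = l \<and> sum_list js = m}"

definition nu :: "nat \<Rightarrow> nat list \<Rightarrow> nat" where
  "nu n d =
     (\<Sum>(i, j) \<in> {(i, j). 1 \<le> i \<and> i < j \<and> j \<le> length d + 1}. ee n d i * ee n d j)"

end

theory Submission
  imports Defs
begin

text \<open>
  Removing the first letter of a word gives a recursion for the inversion generating function
  \<open>G(e)\<close> of the words with multiplicities \<open>e\<close>, and a telescoping sum turns it into MacMahon's
  identity \<open>G(e) \<cdot> \<Prod>\<^sub>i (t)\<^bsub>e\<^sub>i\<^esub> = (t)\<^sub>n\<close> with \<open>(t)\<^sub>m = (1 - t) \<cdots> (1 - t\<^sup>m)\<close>.
  Grouping the positions \<open>1, \<dots>, n\<close> by the segments of \<open>d\<close> identifies \<open>\<Prod>\<^sub>i (t)\<^bsub>e\<^sub>i\<^esub>\<close> with the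
  denominator belonging to \<open>\<epsilon>(d, n)\<close>, which gives the counting formulas. The same grouping
  applied to a refinement \<open>d\<^sup>*\<close> shows that \<open>G\<close> of \<open>d\<^sup>*\<close> is \<open>G\<close> of \<open>d\<close> times the product of the
  generating functions of the blocks. Reversing a word exchanges inversions and non-inversions
  among the \<open>\<nu>(d)\<close> pairs of distinct letters, and swapping an adjacent ascent adds exactly one
  inversion, so every value between 0 and \<open>\<nu>(d)\<close> is attained.
\<close>

subsection \<open>MacMahon's identity\<close>

text \<open>Multiplicities form a function so that deleting a letter is a function update; the
  multiplicity 0, which such deletions produce, is allowed.\<close>

definition mwords :: "nat \<Rightarrow> (nat \<Rightarrow> nat) \<Rightarrow> nat list set" where
  "mwords s e = {u. set u \<subseteq> {1..s} \<and> (\<forall>i\<in>{1..s}. count_list u i = e i)}"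

definition inv_gf :: "nat \<Rightarrow> (nat \<Rightarrow> nat) \<Rightarrow> rat fps" where
  "inv_gf s e = (\<Sum>u\<in>mwords s e. fps_X ^ inversions u)"

definition qfact :: "nat \<Rightarrow> rat fps" where
  "qfact n = (\<Prod>i=1..n. 1 - fps_X ^ i)"

lemma qfact_0 [simp]: "qfact 0 = 1"
  by (simp add: qfact_def)

lemma qfact_Suc: "qfact (Suc n) = (1 - fps_X ^ Suc n) * qfact n"
  by (simp add: qfact_def mult.commute)

lemma fps_nth_prod_0: "fps_nth (prod f A) 0 = (\<Prod>x\<in>A. fps_nth (f x) 0 :: 'a :: comm_ring_1)"
  by (induction A rule: infinite_finite_induct) auto

lemma fps_nth_qfact_0: "fps_nth (qfact n) 0 = 1"
  by (simp add: qfact_def fps_nth_prod_0)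

lemma inversions_Nil [simp]: "inversions [] = 0"
  by (simp add: inversions_def)

text \<open>Pairs of positions split according to whether they involve position 0; the pairs that do
  not are those of \<open>v\<close> shifted by \<open>Suc\<close>.\<close>

lemma inversions_Cons [simp]:
  "inversions (a # v) = length (filter (\<lambda>x. x < a) v) + inversions v"
proof -
  let ?I = "\<lambda>u::nat list. {(p, p'). p < p' \<and> p' < length u \<and> u ! p > u ! p'}"
  let ?A = "(\<lambda>p. (0::nat, Suc p)) ` {p. p < length v \<and> v ! p < a}"
  let ?B = "map_prod Suc Suc ` ?I v"
  have split: "?I (a # v) = ?A \<union> ?B"
  proof (intro set_eqI iffI)
    fix z assume "z \<in> ?I (a # v)"
    then obtain p p' where "z = (p, p')" "p < p'" "p' < length (a # v)" "(a # v) ! p > (a # v) ! p'"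
      by auto
    then show "z \<in> ?A \<union> ?B"
      by (cases p; cases p') auto
  qed auto
  have fin: "finite (?I v)"
    by (rule finite_subset[of _ "{..<length v} \<times> {..<length v}"]) auto
  have "card (?I (a # v)) = card ?A + card ?B"
    unfolding split by (rule card_Un_disjoint) (use fin in auto)
  also have "card ?A = length (filter (\<lambda>x. x < a) v)"
    by (subst card_image) (auto simp: inj_on_def length_filter_conv_card)
  also have "card ?B = card (?I v)"
    by (rule card_image) (auto simp: inj_on_def)
  finally show ?thesis
    by (simp add: inversions_def)
qed

lemma length_filter_eq_sum_count:
  assumes "set u \<subseteq> A" "finite A"
  shows "length (filter P u) = (\<Sum>i | i \<in> A \<and> P i. count_list u i)"
  using assms(1)
proof (induction u)
  case (Cons a u)
  have "(\<Sum>i | i \<in> A \<and> P i. count_list (a # u) i) =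
        (\<Sum>i | i \<in> A \<and> P i. count_list u i) + (\<Sum>i | i \<in> A \<and> P i. if a = i then 1 else 0)"
    by (subst sum.distrib [symmetric]) (auto intro!: sum.cong)
  then show ?case
    using Cons assms(2) by simp
qed simp

lemma length_mwords: "u \<in> mwords s e \<Longrightarrow> length u = (\<Sum>i=1..s. e i)"
  using sum_count_set[of u "{1..s}"] by (auto simp: mwords_def)

lemma finite_mwords: "finite (mwords s e)"
proof (rule finite_subset)
  show "mwords s e \<subseteq> {u. set u \<subseteq> {1..s} \<and> length u = (\<Sum>i=1..s. e i)}"
    using length_mwords by (auto simp: mwords_def)
qed (simp add: finite_lists_length_eq)

text \<open>The guard \<open>e a > 0\<close> matters: subtraction is truncated, so for
  \<open>e a = 0\<close> the update would leave \<open>e\<close> unchanged.\<close>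

lemma Cons_in_mwords_iff:
  "a # v \<in> mwords s e \<longleftrightarrow> a \<in> {1..s} \<and> e a > 0 \<and> v \<in> mwords s (e(a := e a - 1))"
proof
  assume *: "a # v \<in> mwords s e"
  then have a: "a \<in> {1..s}"
    by (auto simp: mwords_def)
  with * have "count_list (a # v) a = e a"
    unfolding mwords_def by blast
  then have "count_list v a + 1 = e a"
    by simp
  with a * show "a \<in> {1..s} \<and> e a > 0 \<and> v \<in> mwords s (e(a := e a - 1))"
    by (auto simp: mwords_def)
qed (auto simp: mwords_def)

lemma mwords_eq_UN:
  assumes "(\<Sum>i=1..s. e i) > 0"
  shows "mwords s e = (\<Union>a\<in>{a\<in>{1..s}. e a > 0}. (#) a ` mwords s (e(a := e a - 1)))"
proof (intro set_eqI iffI)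
  fix u assume u: "u \<in> mwords s e"
  with assms length_mwords[OF u] obtain a v where "u = a # v"
    by (cases u) auto
  with u show "u \<in> (\<Union>a\<in>{a\<in>{1..s}. e a > 0}. (#) a ` mwords s (e(a := e a - 1)))"
    using Cons_in_mwords_iff[of a v s e] by auto
next
  fix u assume "u \<in> (\<Union>a\<in>{a\<in>{1..s}. e a > 0}. (#) a ` mwords s (e(a := e a - 1)))"
  then show "u \<in> mwords s e"
    using Cons_in_mwords_iff by auto
qed

text \<open>A first letter \<open>a\<close> forms an inversion with each later letter below
  \<open>a\<close>. Their number depends only on \<open>e\<close>, so it comes out of the sum as a
  power of t.\<close>

lemma inv_gf_first_letter:
  assumes "(\<Sum>i=1..s. e i) > 0"
  shows "inv_gf s e =
    (\<Sum>a | a \<in> {1..s} \<and> e a > 0. fps_X ^ (\<Sum>i=1..<a. e i) * inv_gf s (e(a := e a - 1)))"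
proof -
  have "inv_gf s e =
      (\<Sum>a | a \<in> {1..s} \<and> e a > 0. \<Sum>u\<in>(#) a ` mwords s (e(a := e a - 1)). fps_X ^ inversions u)"
    unfolding inv_gf_def mwords_eq_UN[OF assms]
    by (rule sum.UNION_disjoint) (auto simp: finite_mwords)
  also have "\<dots> = (\<Sum>a | a \<in> {1..s} \<and> e a > 0. fps_X ^ (\<Sum>i=1..<a. e i) * inv_gf s (e(a := e a - 1)))"
  proof (intro sum.cong refl)
    fix a assume a: "a \<in> {a. a \<in> {1..s} \<and> e a > 0}"
    have less: "length (filter (\<lambda>x. x < a) v) = (\<Sum>i=1..<a. e i)"
      if "v \<in> mwords s (e(a := e a - 1))" for v
    proof -
      have "length (filter (\<lambda>x. x < a) v) = (\<Sum>i | i \<in> {1..s} \<and> i < a. count_list v i)"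
        using that by (intro length_filter_eq_sum_count) (auto simp: mwords_def)
      also have "\<dots> = (\<Sum>i=1..<a. e i)"
        using a that by (intro sum.cong) (auto simp: mwords_def)
      finally show ?thesis .
    qed
    have "(\<Sum>u\<in>(#) a ` mwords s (e(a := e a - 1)). fps_X ^ inversions u :: rat fps) =
        (\<Sum>v\<in>mwords s (e(a := e a - 1)). fps_X ^ inversions (a # v))"
      by (subst sum.reindex) (auto simp: inj_on_def)
    also have "\<dots> = fps_X ^ (\<Sum>i=1..<a. e i) * inv_gf s (e(a := e a - 1))"
      unfolding inv_gf_def sum_distrib_left
      by (intro sum.cong refl) (simp add: less power_add)
    finally show "(\<Sum>u\<in>(#) a ` mwords s (e(a := e a - 1)). fps_X ^ inversions u :: rat fps) =
        fps_X ^ (\<Sum>i=1..<a. e i) * inv_gf s (e(a := e a - 1))" .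
  qed
  finally show ?thesis .
qed

text \<open>Induction on the length. With E(a) = e_1 + ... + e_a, the words beginning with a
  contribute (t)_m (t^E(a-1) - t^E(a)), where m is one less than the length; these terms telescope
  to (t)_m (1 - t^(m+1)).\<close>

theorem MacMahon_inv_gf:
  "inv_gf s e * (\<Prod>i=1..s. qfact (e i)) = qfact (\<Sum>i=1..s. e i)"
proof (induction "\<Sum>i=1..s. e i" arbitrary: e)
  case 0
  then have "\<forall>i\<in>{1..s}. e i = 0"
    by simp
  moreover from this have "mwords s e = {[]}"
    using length_mwords[of _ s e] by (auto simp: mwords_def)
  ultimately show ?case
    by (simp add: inv_gf_def)
next
  case (Suc m)
  let ?E = "\<lambda>a. \<Sum>i=1..a. e i"
  have step: "fps_X ^ (\<Sum>i=1..<a. e i) * inv_gf s (e(a := e a - 1)) * (\<Prod>i=1..s. qfact (e i)) =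
      qfact m * (fps_X ^ ?E (a - 1) - fps_X ^ ?E a)" if a: "a \<in> {1..s}" "e a > 0" for a
  proof -
    let ?e = "e(a := e a - 1)"
    obtain b where b: "e a = Suc b"
      using a(2) by (cases "e a") auto
    have rest: "(\<Prod>i\<in>{1..s}-{a}. qfact (?e i)) = (\<Prod>i\<in>{1..s}-{a}. qfact (e i))"
      by (intro prod.cong) auto
    \<comment> \<open>Only the factor of the letter \<open>a\<close> changes, and it loses exactly 1
      - t^(e a).\<close>
    have P: "(\<Prod>i=1..s. qfact (e i)) = (1 - fps_X ^ e a) * (\<Prod>i=1..s. qfact (?e i))"
      using prod.remove[OF _ a(1), of "\<lambda>i. qfact (e i)"] prod.remove[OF _ a(1), of "\<lambda>i. qfact (?e i)"]
      by (simp only: rest finite_atLeastAtMost) (simp add: b qfact_Suc mult.assoc)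
    have "(\<Sum>i\<in>{1..s}-{a}. ?e i) = (\<Sum>i\<in>{1..s}-{a}. e i)"
      by (intro sum.cong) auto
    then have "m = (\<Sum>i=1..s. ?e i)"
      using Suc.hyps(2) b sum.remove[OF _ a(1), of e] sum.remove[OF _ a(1), of ?e] by simp
    then have Q: "inv_gf s ?e * (\<Prod>i=1..s. qfact (?e i)) = qfact m"
      using Suc.hyps(1)[of ?e] by simp
    have R: "{1..<a} = {1..a - 1}" "?E a = ?E (a - 1) + e a"
      using a(1) by (auto simp: sum.nat_ivl_Suc' simp flip: sum.cl_ivl_Suc) (cases a; simp)
    show ?thesis
      unfolding P R Q [symmetric] power_add by (simp add: algebra_simps)
  qed
  have pos: "(\<Sum>i=1..s. e i) > 0"
    using Suc.hyps(2) by simp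
  have "inv_gf s e * (\<Prod>i=1..s. qfact (e i)) =
      (\<Sum>a | a \<in> {1..s} \<and> e a > 0. qfact m * (fps_X ^ ?E (a - 1) - fps_X ^ ?E a))"
    unfolding inv_gf_first_letter[OF pos] sum_distrib_right
    by (intro sum.cong refl step) auto
  \<comment> \<open>A letter with \<open>e a = 0\<close> has E(a) = E(a-1), so its difference is 0
    and the sum may run over all letters, as telescoping requires.\<close>
  also have "\<dots> = (\<Sum>a=1..s. qfact m * (fps_X ^ ?E (a - 1) - fps_X ^ ?E a))"
  proof (rule sum.mono_neutral_left)
    show "\<forall>a\<in>{1..s} - {a. a \<in> {1..s} \<and> e a > 0}.
        qfact m * (fps_X ^ ?E (a - 1) - fps_X ^ ?E a) = 0"
    proof
      fix a assume "a \<in> {1..s} - {a. a \<in> {1..s} \<and> e a > 0}"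
      then have "?E a = ?E (a - 1)"
        by (cases a) auto
      then show "qfact m * (fps_X ^ ?E (a - 1) - fps_X ^ ?E a) = 0"
        by simp
    qed
  qed auto
  also have "\<dots> = qfact m * (1 - fps_X ^ ?E s)"
    using sum_telescope''[of 0 s "\<lambda>a. - (fps_X ^ ?E a :: rat fps)"]
    by (simp add: sum_distrib_left [symmetric])
  also have "\<dots> = qfact (?E s)"
    using Suc.hyps(2) by (metis qfact_Suc mult.commute)
  finally show ?case .
qed

lemma fps_nth_inv_gf:
  "fps_nth (inv_gf s e) k = of_nat (card {u \<in> mwords s e. inversions u = k})"
proof -
  have "fps_nth (inv_gf s e) k = (\<Sum>u\<in>mwords s e. if inversions u = k then 1 else 0)"
    by (auto simp: inv_gf_def fps_sum_nth fps_X_power_nth intro!: sum.cong)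
  also have "\<dots> = of_nat (card {u \<in> mwords s e. inversions u = k})"
    by (simp add: sum.If_cases finite_mwords Int_def)
  finally show ?thesis .
qed

subsection \<open>Positions grouped into segments\<close>

text \<open>The inserted 0 is d_0. For a position x in 1..n, \<open>x - seg_start d x\<close> is the
  weight w_x of \<open>eps d n\<close>; a maximum is easier to compare between d and a refinement
  than the index j.\<close>

definition seg_start :: "nat list \<Rightarrow> nat \<Rightarrow> nat" where
  "seg_start d x = Max (insert 0 {y \<in> set d. y < x})"

definition seg_prod :: "nat list \<Rightarrow> nat \<Rightarrow> rat fps" where
  "seg_prod d n = (\<Prod>x=1..n. 1 - fps_X ^ (x - seg_start d x))"

lemma dd_0 [simp]: "dd n d 0 = 0"
  by (simp add: dd_def)

lemma dd_last [simp]: "dd n d (Suc (length d)) = n"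
  by (simp add: dd_def nth_append)

lemma dd_Suc: "i < length d \<Longrightarrow> dd n d (Suc i) = d ! i"
  by (simp add: dd_def nth_append)

lemma dd_strict_mono:
  assumes "n > 0" "dim_seq n d" "i < j" "j \<le> length d + 1"
  shows "dd n d i < dd n d j"
proof -
  have "sorted_wrt (<) (0 # d @ [n])"
    using assms(1,2) by (auto simp: dim_seq_def sorted_wrt_append)
  then show ?thesis
    using assms(3,4) by (simp add: dd_def sorted_wrt_iff_nth_less)
qed

lemma dd_mono:
  assumes "n > 0" "dim_seq n d" "i \<le> j" "j \<le> length d + 1"
  shows "dd n d i \<le> dd n d j"
  using dd_strict_mono[OF assms(1,2), of i j] assms(3,4) by (cases "i = j") auto

lemma seg_start_less: "x > 0 \<Longrightarrow> seg_start d x < x"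
  unfolding seg_start_def by (subst Max_less_iff) auto

lemma seg_start_Nil [simp]: "seg_start [] x = 0"
  by (simp add: seg_start_def)

lemma seg_start_eq_dd:
  assumes "n > 0" "dim_seq n d" "j \<le> length d" "dd n d j < x" "x \<le> dd n d (j + 1)"
  shows "seg_start d x = dd n d j"
  unfolding seg_start_def
proof (rule Max_eqI)
  fix y assume "y \<in> insert 0 {y \<in> set d. y < x}"
  then consider "y = 0" | i where "i < length d" "y = d ! i" "y < x"
    by (auto simp: in_set_conv_nth)
  then show "y \<le> dd n d j"
  proof cases
    case 2
    \<comment> \<open>The list is indexed from 0, so \<open>d ! i\<close> is d_{i+1}. If i >= j, it
      would be at least d_{j+1}, hence at least x.\<close>
    have "i < j"
    proof (rule ccontr)
      assume "\<not> i < j"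
      then have "dd n d (j + 1) \<le> dd n d (Suc i)"
        using 2 by (intro dd_mono assms(1,2)) auto
      with 2 assms(5) show False
        by (simp add: dd_Suc)
    qed
    then have "dd n d (Suc i) \<le> dd n d j"
      using assms(3) by (intro dd_mono assms(1,2)) auto
    with 2 show ?thesis
      by (simp add: dd_Suc)
  qed simp
next
  show "dd n d j \<in> insert 0 {y \<in> set d. y < x}"
    using assms(3,4) by (cases j) (auto simp: dd_Suc)
qed simp

text \<open>If x is at most \<open>g m\<close>, the induction hypothesis supplies j; otherwise j = m
  works.\<close>

lemma ex_segment:
  fixes g :: "nat \<Rightarrow> nat"
  shows "g 0 < x \<Longrightarrow> x \<le> g m \<Longrightarrow> \<exists>j<m. g j < x \<and> x \<le> g (j + 1)"
proof (induction m)
  case (Suc m)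
  then show ?case
    by (cases "x \<le> g m") (auto simp: less_Suc_eq not_le)
qed simp

text \<open>This removes the definite description from \<open>eps\<close>: j exists by
  \<open>ex_segment\<close>, and it is unique because the half-open segments of different indices
  are disjoint.\<close>

lemma nth_eps:
  assumes "n > 0" "dim_seq n d" "i < n"
  shows "eps d n ! i = Suc i - seg_start d (Suc i)"
proof -
  let ?P = "\<lambda>j. j \<le> length d \<and> dd n d j < Suc i \<and> Suc i \<le> dd n d (j + 1)"
  obtain j where j: "?P j"
    using ex_segment[of "dd n d" "Suc i" "Suc (length d)"] assms by (auto simp: less_Suc_eq_le)
  have "j' = j" if "?P j'" for j'
  proof (rule ccontr)
    assume "j' \<noteq> j"
    then consider "j' + 1 \<le> j" | "j + 1 \<le> j'"
      by linarith
    then show False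
      using dd_mono[OF assms(1,2), of "j' + 1" j] dd_mono[OF assms(1,2), of "j + 1" j'] that j
      by cases auto
  qed
  then have "(THE j. ?P j) = j"
    using j by (intro the_equality)
  then have "eps d n ! i = Suc i - dd n d j"
    using assms(3) by (simp add: eps_def del: upt_Suc)
  also have "dd n d j = seg_start d (Suc i)"
    using seg_start_eq_dd[OF assms(1,2), of j "Suc i"] j by simp
  finally show ?thesis .
qed

lemma length_eps [simp]: "length (eps d n) = n"
  by (simp add: eps_def)

lemma prod_eps:
  assumes "n > 0" "dim_seq n d"
  shows "(\<Prod>i<n. 1 - fps_X ^ (eps d n ! i)) = seg_prod d n"
proof -
  have "(\<Prod>i<n. 1 - fps_X ^ (eps d n ! i) :: rat fps) = (\<Prod>i<n. 1 - fps_X ^ (Suc i - seg_start d (Suc i)))"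
    by (intro prod.cong refl) (simp add: nth_eps[OF assms])
  also have "\<dots> = seg_prod d n"
    by (simp add: seg_prod_def prod.atLeast1_atMost_eq)
  finally show ?thesis .
qed

text \<open>All exponents are positive because a segment starts strictly before each of its
  positions. Hence \<open>seg_prod d n\<close> is invertible and can be cancelled.\<close>

lemma fps_nth_seg_prod_0: "fps_nth (seg_prod d n) 0 = 1"
proof -
  have "x - seg_start d x \<noteq> 0" if "x \<in> {1..n}" for x
    using seg_start_less[of x d] that by simp
  then show ?thesis
    by (auto simp: seg_prod_def fps_nth_prod_0 intro!: prod.neutral)
qed

section \<open>Splitting the denominator of a refinement into blocks\<close>

lemma prod_segments:
  fixes g :: "nat \<Rightarrow> nat"
  assumes "\<And>i. i < m \<Longrightarrow> g i \<le> g (Suc i)"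
  shows "(\<Prod>i=1..m. \<Prod>x\<in>{g (i - 1)<..g i}. f x) = (\<Prod>x\<in>{g 0<..g m}. f x)"
  using assms
proof (induction m)
  case (Suc m)
  have "g 0 \<le> g m"
    by (rule dec_induct[of 0 m]) (use Suc.prems in \<open>auto intro: le_trans\<close>)
  then have "{g 0<..g (Suc m)} = {g 0<..g m} \<union> {g m<..g (Suc m)}"
    using Suc.prems[of m] by auto
  then have "(\<Prod>x\<in>{g 0<..g (Suc m)}. f x) = (\<Prod>x\<in>{g 0<..g m}. f x) * (\<Prod>x\<in>{g m<..g (Suc m)}. f x)"
    by (simp only:) (rule prod.union_disjoint; auto)
  then show ?case
    using Suc by simp
qed simp

text \<open>The last member of \<open>ds\<close> before a position of block i is either inside the
  block or the left end of the block. That end is 0 or a member of \<open>ds\<close>, and after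
  translation it becomes the 0 inserted by \<open>seg_start\<close>. So weights computed in
  \<open>ds\<close> and in the block agree.\<close>

lemma seg_start_block:
  assumes "n > 0" "dim_seq n d" "set d \<subseteq> set ds" "i \<in> {1..length d + 1}" "0 < x" "x \<le> ee n d i"
  shows "seg_start ds (dd n d (i - 1) + x) = dd n d (i - 1) + seg_start (block n d ds i) x"
proof -
  let ?a = "dd n d (i - 1)" and ?b = "dd n d i" and ?M = "seg_start (block n d ds i) x"
  have xb: "?a + x \<le> ?b"
    using assms(6) dd_mono[OF assms(1,2), of "i - 1" i] assms(4,5) by (auto simp: ee_def)
  have a: "?a = 0 \<or> ?a \<in> set ds"
  proof (cases "i - 1")
    case (Suc k)
    then have k: "k < length d"
      using assms(4) by auto
    then have "d ! k \<in> set ds"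
      using assms(3) nth_mem by blast
    then show ?thesis
      using Suc dd_Suc[OF k, of n] by simp
  qed simp
  have M_in: "?M \<in> insert 0 {y \<in> set (block n d ds i). y < x}"
    unfolding seg_start_def by (rule Max_in) auto
  have M_ge: "y \<le> ?M" if "y \<in> set (block n d ds i)" "y < x" for y
    unfolding seg_start_def using that by (intro Max_ge) auto
  show ?thesis
    unfolding seg_start_def[of ds]
  proof (rule Max_eqI)
    fix y assume y: "y \<in> insert 0 {y \<in> set ds. y < ?a + x}"
    show "y \<le> ?a + ?M"
    proof (cases "y \<le> ?a")
      case False
      with y xb have "y - ?a \<in> set (block n d ds i)" "y - ?a < x"
        by (auto simp: block_def)
      then have "y - ?a \<le> ?M"
        by (rule M_ge)
      then show ?thesis
        by simp
    qed simp
  next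
    show "?a + ?M \<in> insert 0 {y \<in> set ds. y < ?a + x}"
      using M_in a assms(5) by (auto simp: block_def)
  qed simp
qed

lemma seg_prod_blocks:
  assumes "n > 0" "dim_seq n d" "set d \<subseteq> set ds"
  shows "seg_prod ds n = (\<Prod>i=1..length d + 1. seg_prod (block n d ds i) (ee n d i))"
proof -
  let ?f = "\<lambda>x. 1 - fps_X ^ (x - seg_start ds x) :: rat fps"
  have "seg_prod ds n = (\<Prod>x\<in>{dd n d 0<..dd n d (length d + 1)}. ?f x)"
    unfolding seg_prod_def by (intro prod.cong) auto
  also have "\<dots> = (\<Prod>i=1..length d + 1. \<Prod>x\<in>{dd n d (i - 1)<..dd n d i}. ?f x)"
    by (rule prod_segments [symmetric]) (use assms in \<open>auto intro!: dd_mono\<close>)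
  also have "\<dots> = (\<Prod>i=1..length d + 1. seg_prod (block n d ds i) (ee n d i))"
  proof (intro prod.cong refl)
    fix i assume i: "i \<in> {1..length d + 1}"
    let ?a = "dd n d (i - 1)"
    have ab: "dd n d i = ?a + ee n d i"
      using dd_mono[OF assms(1,2), of "i - 1" i] i by (auto simp: ee_def)
    have "(\<Prod>x\<in>{?a<..dd n d i}. ?f x) = (\<Prod>x=1..ee n d i. ?f (?a + x))"
      unfolding ab by (rule prod.reindex_bij_witness[of _ "\<lambda>x. ?a + x" "\<lambda>x. x - ?a"]) auto
    also have "\<dots> = seg_prod (block n d ds i) (ee n d i)"
      unfolding seg_prod_def
      by (intro prod.cong refl) (use seg_start_block[OF assms i] in auto)
    finally show "(\<Prod>x\<in>{?a<..dd n d i}. ?f x) = seg_prod (block n d ds i) (ee n d i)" .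
  qed
  finally show ?thesis .
qed

lemma block_self:
  assumes "n > 0" "dim_seq n d" "i \<in> {1..length d + 1}"
  shows "block n d d i = []"
proof -
  have "\<not> (dd n d (i - 1) < d ! k \<and> d ! k < dd n d i)" if "k < length d" for k
  proof (cases "Suc k \<le> i - 1")
    case True
    then have "dd n d (Suc k) \<le> dd n d (i - 1)"
      using assms(3) by (intro dd_mono[OF assms(1,2)]) auto
    with that show ?thesis
      by (simp add: dd_Suc)
  next
    case False
    then have "dd n d i \<le> dd n d (Suc k)"
      using that by (intro dd_mono[OF assms(1,2)]) auto
    with that show ?thesis
      by (simp add: dd_Suc)
  qed
  then show ?thesis
    by (auto simp: block_def filter_empty_conv in_set_conv_nth)
qed

lemma seg_prod_Nil: "seg_prod [] n = qfact n"
  by (simp add: seg_prod_def qfact_def)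

text \<open>Viewed as a refinement of itself, \<open>d\<close> has only empty blocks, and an empty
  block of length e_i contributes (t)_{e_i}.\<close>

lemma prod_qfact_ee:
  assumes "n > 0" "dim_seq n d"
  shows "(\<Prod>i=1..length d + 1. qfact (ee n d i)) = seg_prod d n"
  unfolding seg_prod_blocks[OF assms subset_refl]
  by (intro prod.cong refl) (simp add: block_self[OF assms] seg_prod_Nil)

lemma sum_ee:
  assumes "n > 0" "dim_seq n d"
  shows "(\<Sum>i=1..length d + 1. ee n d i) = n"
proof -
  have "(\<Sum>i=1..m. ee n d i) = dd n d m" if "m \<le> length d + 1" for m
    using that
  proof (induction m)
    case (Suc m)
    then show ?case
      using dd_mono[OF assms, of m "Suc m"] by (simp add: ee_def)
  qed simp
  from this[of "length d + 1"] show ?thesis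
    by simp
qed

text \<open>The length n is forced by the multiplicities, since the e_i telescope to n.\<close>

lemma words_eq_mwords:
  assumes "n > 0" "dim_seq n d"
  shows "words n d = mwords (length d + 1) (ee n d)"
proof -
  have "length u = n" if "u \<in> mwords (length d + 1) (ee n d)" for u
    using length_mwords[OF that] sum_ee[OF assms] by simp
  then show ?thesis
    unfolding words_def mwords_def by blast
qed

subsection \<open>The generating function of a dimension sequence\<close>

definition words_gf :: "nat \<Rightarrow> nat list \<Rightarrow> rat fps" where
  "words_gf n d = inv_gf (length d + 1) (ee n d)"

lemma fps_nth_words_gf:
  assumes "n > 0" "dim_seq n d"
  shows "fps_nth (words_gf n d) k = of_nat (inv_words n d (int k))"
  by (simp add: words_gf_def fps_nth_inv_gf inv_words_def words_eq_mwords[OF assms])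

lemma words_gf_mult_seg_prod:
  assumes "n > 0" "dim_seq n d"
  shows "words_gf n d * seg_prod d n = qfact n"
  using MacMahon_inv_gf[of "length d + 1" "ee n d"]
  unfolding prod_qfact_ee[OF assms] sum_ee[OF assms] words_gf_def .

text \<open>Constant terms are compared in MacMahon's identity, so no word has to be
  exhibited.\<close>

lemma inv_words_0:
  assumes "n > 0" "dim_seq n d"
  shows "inv_words n d 0 = 1"
proof -
  have "fps_nth (words_gf n d * seg_prod d n) 0 = 1"
    unfolding words_gf_mult_seg_prod[OF assms] by (rule fps_nth_qfact_0)
  then show ?thesis
    by (simp add: fps_nth_seg_prod_0 fps_nth_words_gf[OF assms])
qed

subsection \<open>Counting formulas\<close>

lemma denum_eq:
  "denum w m =
    (if m < 0 then 0 else fps_nth (inverse (\<Prod>i<length w. 1 - fps_X ^ (w ! i))) (nat m))"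
  by (simp add: denum_def inverse_prod_fps)

text \<open>Expanding the product, T collects the indices i whose factor contributes -t^i.\<close>

lemma qfact_eq_sum: "qfact r = (\<Sum>T\<in>Pow {1..r}. (-1) ^ card T * fps_X ^ omega T)"
  unfolding qfact_def omega_def by (subst prod_diff_conv_sum) (simp_all add: power_sum)

text \<open>Multiplication by t^omega(T) shifts coefficients, and the value 0 of
  \<open>denum\<close> at negative arguments covers the T with omega(T) > m.\<close>

lemma fps_nth_qfact_mult_inverse:
  "fps_nth (qfact r * inverse (\<Prod>i<length w. 1 - fps_X ^ (w ! i))) m =
    (\<Sum>T\<in>Pow {1..r}. (-1) ^ card T * denum w (int m - int (omega T)))"
proof -
  let ?F = "inverse (\<Prod>i<length w. 1 - fps_X ^ (w ! i)) :: rat fps"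
  have "fps_nth (qfact r * ?F) m = (\<Sum>T\<in>Pow {1..r}. fps_nth (fps_const ((-1) ^ card T) * (fps_X ^ omega T * ?F)) m)"
    unfolding qfact_eq_sum sum_distrib_right fps_sum_nth
    by (simp add: mult.assoc flip: fps_const_power fps_const_neg)
  also have "\<dots> = (\<Sum>T\<in>Pow {1..r}. (-1) ^ card T * denum w (int m - int (omega T)))"
    by (intro sum.cong refl)
      (auto simp: fps_X_power_mult_nth denum_eq nat_diff_distrib simp del: fps_const_power fps_const_neg)
  finally show ?thesis .
qed

text \<open>Positive weights give the denominator the constant term 1, so division is multiplication
  by the inverse series.\<close>

lemma qfact_divide_eq:
  assumes "\<forall>x\<in>set w. x > 0"
  shows "qfact r / (\<Prod>i<length w. 1 - fps_X ^ (w ! i)) =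
    Abs_fps (\<lambda>m. \<Sum>T\<in>Pow {1..r}. (-1) ^ card T * denum w (int m - int (omega T)))"
proof -
  have "fps_nth (\<Prod>i<length w. 1 - fps_X ^ (w ! i) :: rat fps) 0 \<noteq> 0"
    using assms by (auto simp: fps_nth_prod_0)
  then show ?thesis
    by (intro fps_ext) (simp add: fps_divide_unit fps_nth_qfact_mult_inverse)
qed

text \<open>The subsets are grouped by the value of \<open>omega\<close>; those with value above k
  drop out because g vanishes there.\<close>

lemma sum_Pow_omega_eq_sum_psi:
  fixes g :: "nat \<Rightarrow> rat"
  assumes "\<And>i. i > k \<Longrightarrow> g i = 0"
  shows "(\<Sum>T\<in>Pow {1..n}. (-1) ^ card T * g (omega T)) = (\<Sum>i=0..k. of_int (psi n i) * g i)"
proof -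
  have "(\<Sum>T\<in>Pow {1..n}. (-1) ^ card T * g (omega T)) =
      (\<Sum>T | T \<subseteq> {1..n} \<and> omega T \<le> k. (-1) ^ card T * g (omega T))"
    by (rule sum.mono_neutral_right) (use assms not_le in auto)
  also have "\<dots> = (\<Sum>i=0..k. \<Sum>T | T \<in> {T. T \<subseteq> {1..n} \<and> omega T \<le> k} \<and> omega T = i. (-1) ^ card T * g (omega T))"
    by (rule sum.group [symmetric]) auto
  also have "\<dots> = (\<Sum>i=0..k. of_int (psi n i) * g i)"
  proof (intro sum.cong refl)
    fix i assume "i \<in> {0..k}"
    then have "{T. T \<in> {T. T \<subseteq> {1..n} \<and> omega T \<le> k} \<and> omega T = i} = {T. T \<subseteq> {1..n} \<and> omega T = i}"
      by auto
    then show "(\<Sum>T | T \<in> {T. T \<subseteq> {1..n} \<and> omega T \<le> k} \<and> omega T = i. (-1) ^ card T * g (omega T)) =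
        of_int (psi n i) * g i"
      by (simp add: psi_def sum_distrib_right)
  qed
  finally show ?thesis .
qed

lemma inv_words_eq_sum_denum:
  assumes "n > 0" "dim_seq n d"
  shows "of_nat (inv_words n d (int k)) =
    (\<Sum>T\<in>Pow {1..n}. (-1) ^ card T * denum (eps d n) (int k - int (omega T)))"
proof -
  have "seg_prod d n * inverse (seg_prod d n) = 1"
    by (rule inverse_mult_eq_1') (simp add: fps_nth_seg_prod_0)
  then have "words_gf n d = qfact n * inverse (seg_prod d n)"
    unfolding words_gf_mult_seg_prod[OF assms, symmetric] by (simp add: mult.assoc)
  then show ?thesis
    using fps_nth_qfact_mult_inverse[of n "eps d n" k]
    by (simp add: prod_eps[OF assms] fps_nth_words_gf[OF assms, symmetric])
qed

lemma inv_words_eq_sum_psi: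
  assumes "n > 0" "dim_seq n d"
  shows "of_nat (inv_words n d (int k)) = (\<Sum>i=0..k. of_int (psi n i) * denum (eps d n) (int k - int i))"
  unfolding inv_words_eq_sum_denum[OF assms]
  by (rule sum_Pow_omega_eq_sum_psi[where g = "\<lambda>i. denum (eps d n) (int k - int i)"])
    (simp add: denum_def)

section \<open>Permutations: the sequence 1 < 2 < ... < n-1\<close>

lemma dim_seq_upt: "dim_seq n [1..<n]"
  by (auto simp: dim_seq_def)

text \<open>Every segment is a single position, so all weights are 1.\<close>

lemma seg_prod_upt: "seg_prod [1..<n] n = (1 - fps_X) ^ n"
proof -
  have "seg_start [1..<n] x = x - 1" if "x \<in> {1..n}" for x
    unfolding seg_start_def by (rule Max_eqI) (use that in auto)
  then have "seg_prod [1..<n] n = (\<Prod>x=1..n. 1 - fps_X)"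
    unfolding seg_prod_def by (intro prod.cong) auto
  then show ?thesis
    by simp
qed

lemma binom_of_nat: "binom (int a) (int b) = of_nat (a choose b)"
proof (cases "b \<le> a")
  case True
  have "(\<Prod>i<b. (of_nat a - of_nat i) / (of_nat i + 1) :: rat) = of_nat (a choose b)"
    by (simp add: binomial_gbinomial gbinomial_prod_rev prod_dividef fact_prod_Suc atLeast0LessThan add.commute)
  with True show ?thesis
    by (simp add: binom_def)
qed (simp add: binom_def binomial_eq_0)

lemma denum_eps_upt:
  assumes "n > 0"
  shows "denum (eps [1..<n] n) m = binom (int n - 1 + m) (int n - 1)"
proof (cases "m < 0")
  case False
  then obtain k where k: "m = int k"
    using nonneg_int_cases by (metis not_le)
  have "denum (eps [1..<n] n) m = fps_nth (inverse ((1 - fps_X) ^ n)) k"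
    by (simp add: denum_eq prod_eps[OF assms dim_seq_upt] seg_prod_upt k del: One_nat_def)
  also have "\<dots> = of_nat (n + k - 1 choose k)"
    using one_minus_const_fps_X_neg_power'[OF assms, of "1::rat"] by simp
  also have "n + k - 1 choose k = n - 1 + k choose (n - 1)"
    using assms binomial_symmetric[of k "n + k - 1"] by simp
  also have "of_nat \<dots> = binom (int n - 1 + m) (int n - 1)"
    using assms binom_of_nat[of "n - 1 + k" "n - 1"] by (simp add: k of_nat_diff algebra_simps)
  finally show ?thesis .
\<comment> \<open>For m < 0 the upper argument n-1+m is below n-1, so \<open>binom\<close> is 0 just
  as \<open>denum\<close> is.\<close>
qed (auto simp: denum_def binom_def)

lemma inv_perms_eq_sum_binom:
  assumes "n > 0"
  shows "of_nat (inv_perms n (int k)) =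
    (\<Sum>T\<in>Pow {1..n}. (-1) ^ card T * binom (int n - 1 + int k - int (omega T)) (int n - 1))"
  unfolding inv_perms_def inv_words_eq_sum_denum[OF assms dim_seq_upt] denum_eps_upt[OF assms]
  by (simp only: add_diff_eq)

lemma inv_perms_eq_sum_psi:
  assumes "n > 0"
  shows "of_nat (inv_perms n (int k)) =
    (\<Sum>i=0..k. of_int (psi n i) * binom (int n - 1 + int k - int i) (int n - 1))"
  unfolding inv_perms_def inv_words_eq_sum_psi[OF assms dim_seq_upt] denum_eps_upt[OF assms]
  by (simp only: add_diff_eq)

subsection \<open>Refinements\<close>

lemma dim_seq_block:
  assumes "n > 0" "dim_seq n d" "refinement n d ds" "i \<in> {1..length d + 1}"
  shows "ee n d i > 0" "dim_seq (ee n d i) (block n d ds i)"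
proof -
  show "ee n d i > 0"
    using dd_strict_mono[OF assms(1,2), of "i - 1" i] assms(4) by (auto simp: ee_def)
  let ?a = "dd n d (i - 1)"
  let ?l = "filter (\<lambda>x. ?a < x \<and> x < dd n d i) ds"
  have "sorted_wrt (<) ?l"
    using assms(3) by (auto simp: refinement_def dim_seq_def intro: sorted_wrt_filter)
  \<comment> \<open>Truncated subtraction stays strictly monotone here because all entries left by
    the filter exceed \<open>?a\<close>.\<close>
  then have "sorted_wrt (\<lambda>x y. x - ?a < y - ?a) ?l"
    by (rule sorted_wrt_mono_rel[rotated]) auto
  then show "dim_seq (ee n d i) (block n d ds i)"
    by (auto simp: dim_seq_def block_def sorted_wrt_map ee_def)
qed

text \<open>Multiplied by \<open>seg_prod ds n\<close>, both sides become (t)_n: on the right,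
  MacMahon's identity in each block turns the product into that of the (t)_{e_i}, which is the
  denominator of d. The nonzero factor is then cancelled.\<close>

lemma words_gf_refinement:
  assumes "n > 0" "dim_seq n d" "refinement n d ds"
  shows "words_gf n ds = words_gf n d * (\<Prod>i=1..length d + 1. words_gf (ee n d i) (block n d ds i))"
proof -
  have ds: "dim_seq n ds" "set d \<subseteq> set ds"
    using assms(3) by (auto simp: refinement_def)
  have "seg_prod d n = (\<Prod>i=1..length d + 1. qfact (ee n d i))"
    by (rule prod_qfact_ee[OF assms(1,2), symmetric])
  also have "\<dots> = (\<Prod>i=1..length d + 1. words_gf (ee n d i) (block n d ds i) * seg_prod (block n d ds i) (ee n d i))"
    by (intro prod.cong refl words_gf_mult_seg_prod [symmetric] dim_seq_block[OF assms])
  also have "\<dots> = (\<Prod>i=1..length d + 1. words_gf (ee n d i) (block n d ds i)) * seg_prod ds n"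
    unfolding seg_prod_blocks[OF assms(1,2) ds(2)] by (rule prod.distrib)
  finally have "words_gf n ds * seg_prod ds n =
      (words_gf n d * (\<Prod>i=1..length d + 1. words_gf (ee n d i) (block n d ds i))) * seg_prod ds n"
    using words_gf_mult_seg_prod[OF assms(1,2)] words_gf_mult_seg_prod[OF assms(1) ds(1)]
    by (simp add: mult.assoc)
  moreover have "seg_prod ds n \<noteq> 0"
    using fps_nth_seg_prod_0[of ds n] by auto
  ultimately show ?thesis
    using mult_right_cancel by blast
qed

lemma fps_nth_prod_tuples:
  fixes f :: "nat \<Rightarrow> rat fps"
  shows "fps_nth (\<Prod>i=1..l + 1. f i) m = (\<Sum>js\<in>tuples (l + 1) m. \<Prod>i=1..l + 1. fps_nth (f i) (js ! (i - 1)))"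
proof -
  have shift: "(\<Prod>i=1..l + 1. g i) = (\<Prod>i=0..l. g (Suc i))" for g :: "nat \<Rightarrow> 'b :: comm_monoid_mult"
    by (simp add: prod.atLeast_Suc_atMost_Suc_shift del: prod.cl_ivl_Suc)
  show ?thesis
    unfolding shift fps_prod_nth by (simp add: natpermute_def tuples_def)
qed

text \<open>The coefficient of t^k in \<open>words_gf_refinement\<close> is a convolution. Its m = 0
  term is I_n(d;k), since \<open>Q 0 = 1\<close>; the other terms move to the other side.\<close>

lemma inv_words_refinement:
  assumes "n > 0" "dim_seq n d" "refinement n d ds"
  shows "int (inv_words n d (int k)) = int (inv_words n ds (int k)) -
    (\<Sum>m=1..k. (\<Sum>js\<in>tuples (length d + 1) m.
        \<Prod>i=1..length d + 1. int (inv_words (ee n d i) (block n d ds i) (int (js ! (i - 1)))))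
      * int (inv_words n d (int k - int m)))"
proof -
  define Q where "Q m = (\<Sum>js\<in>tuples (length d + 1) m.
        \<Prod>i=1..length d + 1. int (inv_words (ee n d i) (block n d ds i) (int (js ! (i - 1)))))" for m
  let ?B = "\<Prod>i=1..length d + 1. words_gf (ee n d i) (block n d ds i)"
  have ds: "dim_seq n ds"
    using assms(3) by (auto simp: refinement_def)
  have Q: "fps_nth ?B m = of_int (Q m)" for m
    unfolding fps_nth_prod_tuples Q_def of_int_sum of_int_prod
    by (intro sum.cong prod.cong refl)
      (simp add: fps_nth_words_gf[OF dim_seq_block[OF assms]])
  have "fps_nth ?B 0 = 1"
    unfolding fps_nth_prod_0
    by (intro prod.neutral ballI)
      (simp add: fps_nth_words_gf[OF dim_seq_block[OF assms]] inv_words_0[OF dim_seq_block[OF assms]])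
  then have Q0: "Q 0 = 1"
    unfolding Q by simp
  have "of_int (int (inv_words n ds (int k))) = fps_nth (?B * words_gf n d) k"
    using words_gf_refinement[OF assms] fps_nth_words_gf[OF assms(1) ds, of k]
    by (simp add: mult.commute)
  also have "\<dots> = (\<Sum>m=0..k. of_int (Q m) * of_int (int (inv_words n d (int k - int m))))"
    unfolding fps_mult_nth Q
    by (intro sum.cong refl) (simp add: fps_nth_words_gf[OF assms(1,2)] of_nat_diff)
  also have "\<dots> = of_int (\<Sum>m=0..k. Q m * int (inv_words n d (int k - int m)))"
    by simp
  finally have "int (inv_words n ds (int k)) = (\<Sum>m=0..k. Q m * int (inv_words n d (int k - int m)))"
    by (simp only: of_int_eq_iff)
  also have "\<dots> = int (inv_words n d (int k)) + (\<Sum>m=1..k. Q m * int (inv_words n d (int k - int m)))"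
    by (simp add: sum.atLeast_Suc_atMost Q0)
  finally show ?thesis
    by (simp add: Q_def)
qed

lemma inv_words_le_refinement:
  assumes "n > 0" "dim_seq n d" "refinement n d ds"
  shows "inv_words n d (int k) \<le> inv_words n ds (int k)"
proof -
  have "(\<Sum>m=1..k. (\<Sum>js\<in>tuples (length d + 1) m.
        \<Prod>i=1..length d + 1. int (inv_words (ee n d i) (block n d ds i) (int (js ! (i - 1)))))
      * int (inv_words n d (int k - int m))) \<ge> 0"
    by (intro sum_nonneg mult_nonneg_nonneg prod_nonneg) auto
  then show ?thesis
    using inv_words_refinement[OF assms, of k] by linarith
qed

subsection \<open>Symmetry and positivity\<close>

lemma inversions_snoc:
  "inversions (v @ [a]) = inversions v + length (filter (\<lambda>x. x > a) v)"
  by (induction v) auto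

text \<open>Count ordered pairs of positions. Pairs with equal letters give the sum of squares; two
  positions with different letters form an inversion in exactly one of \<open>u\<close> and
  \<open>rev u\<close> and are counted in both orders.\<close>

lemma inversions_add_inversions_rev:
  assumes "set u \<subseteq> A" "finite A"
  shows "2 * (inversions u + inversions (rev u)) + (\<Sum>i\<in>A. (count_list u i)\<^sup>2) = (length u)\<^sup>2"
  using assms(1)
proof (induction u)
  case (Cons a u)
  have "(\<Sum>i\<in>A. (count_list (a # u) i)\<^sup>2) =
      (\<Sum>i\<in>A. (count_list u i)\<^sup>2 + (if a = i then 2 * count_list u a + 1 else 0))"
    by (intro sum.cong) (auto simp: power2_eq_square)
  also have "\<dots> = (\<Sum>i\<in>A. (count_list u i)\<^sup>2) + (2 * count_list u a + 1)"
    using Cons.prems assms(2) by (simp add: sum.distrib)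
  finally have sq: "(\<Sum>i\<in>A. (count_list (a # u) i)\<^sup>2) =
      (\<Sum>i\<in>A. (count_list u i)\<^sup>2) + (2 * count_list u a + 1)" .
  have "length (filter (\<lambda>x. x < a) u) + length (filter (\<lambda>x. x > a) u) + count_list u a = length u"
    by (induction u) auto
  then show ?case
    using Cons sq by (simp add: inversions_snoc rev_filter [symmetric] power2_eq_square algebra_simps)
qed simp

lemma sum_squared_eq:
  fixes e :: "nat \<Rightarrow> nat"
  shows "(\<Sum>i=1..s. e i)\<^sup>2 = (\<Sum>i=1..s. (e i)\<^sup>2) +
    2 * (\<Sum>(i, j) \<in> {(i, j). 1 \<le> i \<and> i < j \<and> j \<le> s}. e i * e j)"
proof (induction s)
  case 0
  have empty: "{(i, j). 1 \<le> i \<and> i < j \<and> j \<le> (0::nat)} = {}"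
    by auto
  show ?case
    unfolding empty by simp
next
  case (Suc s)
  let ?S = "\<lambda>s. {(i, j). 1 \<le> i \<and> i < j \<and> j \<le> (s::nat)}"
  have "?S (Suc s) = ?S s \<union> (\<lambda>i. (i, Suc s)) ` {1..s}"
    by (auto simp: le_Suc_eq)
  moreover have "finite (?S s)"
    by (rule finite_subset[of _ "{1..s} \<times> {1..s}"]) auto
  ultimately have "(\<Sum>(i, j)\<in>?S (Suc s). e i * e j) =
      (\<Sum>(i, j)\<in>?S s. e i * e j) + (\<Sum>(i, j)\<in>(\<lambda>i. (i, Suc s)) ` {1..s}. e i * e j)"
    by (simp only:) (rule sum.union_disjoint; auto)
  also have "(\<Sum>(i, j)\<in>(\<lambda>i. (i, Suc s)) ` {1..s}. e i * e j) = (\<Sum>i=1..s. e i) * e (Suc s)"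
    by (subst sum.reindex) (auto simp: inj_on_def sum_distrib_right)
  finally show ?case
    using Suc.IH by (simp add: power2_eq_square algebra_simps)
qed

lemma square_eq_sum_two_nu:
  assumes "n > 0" "dim_seq n d"
  shows "n\<^sup>2 = (\<Sum>i=1..length d + 1. (ee n d i)\<^sup>2) + 2 * nu n d"
  using sum_squared_eq[of "ee n d" "length d + 1"] unfolding sum_ee[OF assms] nu_def .

text \<open>Since e_i is at most its square, n is at most the sum of the squares, which is n^2 - 2
  nu(d).\<close>

lemma nu_le:
  assumes "n > 0" "dim_seq n d"
  shows "(of_nat (nu n d) :: rat) \<le> of_nat n * (of_nat n - 1) / 2"
proof -
  have "(\<Sum>i=1..length d + 1. ee n d i) \<le> (\<Sum>i=1..length d + 1. (ee n d i)\<^sup>2)"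
    by (intro sum_mono) (simp add: power2_eq_square)
  then have "n + 2 * nu n d \<le> n\<^sup>2"
    using square_eq_sum_two_nu[OF assms] unfolding sum_ee[OF assms] by linarith
  then have "(of_nat (n + 2 * nu n d) :: rat) \<le> of_nat (n\<^sup>2)"
    by (simp only: of_nat_le_iff)
  then show ?thesis
    by (simp add: power2_eq_square algebra_simps)
qed

lemma inversions_rev_words:
  assumes "n > 0" "dim_seq n d" "u \<in> words n d"
  shows "inversions u + inversions (rev u) = nu n d"
proof -
  have u: "length u = n" "set u \<subseteq> {1..length d + 1}" "\<And>i. i \<in> {1..length d + 1} \<Longrightarrow> count_list u i = ee n d i"
    using assms(3) unfolding words_def by blast+
  have "2 * (inversions u + inversions (rev u)) + (\<Sum>i=1..length d + 1. (ee n d i)\<^sup>2) = n\<^sup>2"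
    using inversions_add_inversions_rev[OF u(2)] u(1,3) by simp
  then show ?thesis
    unfolding square_eq_sum_two_nu[OF assms(1,2)] by (metis add.commute add_left_cancel nat_mult_eq_cancel_disj zero_neq_numeral)
qed

text \<open>Reversal is an involution on the words that replaces the number of inversions by its
  complement in nu(d). As k is an integer, values above nu(d) are paired with negative ones.\<close>

lemma inv_words_symmetric:
  assumes "n > 0" "dim_seq n d"
  shows "inv_words n d k = inv_words n d (int (nu n d) - k)"
proof -
  have rev: "rev u \<in> words n d" if "u \<in> words n d" for u
    using that by (simp add: words_def)
  have "bij_betw rev {u \<in> words n d. int (inversions u) = k}
      {u \<in> words n d. int (inversions u) = int (nu n d) - k}"
    by (rule bij_betwI[of _ _ _ rev]) (use rev inversions_rev_words[OF assms] in fastforce)+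
  then show ?thesis
    unfolding inv_words_def by (rule bij_betw_same_card)
qed

section \<open>Attaining every number of inversions\<close>

lemma ex_ascent:
  fixes u :: "nat list"
  assumes "\<not> sorted (rev u)"
  shows "\<exists>xs a b ys. u = xs @ a # b # ys \<and> a < b"
proof -
  have "\<not> sorted_wrt (\<ge>) u"
    using assms by (simp add: sorted_wrt_rev)
  then obtain i where i: "Suc i < length u" "u ! i < u ! Suc i"
    by (auto simp: sorted_wrt_iff_nth_Suc_transp transp_def not_le)
  then have "u = take i u @ u ! i # u ! Suc i # drop (Suc (Suc i)) u"
    by (metis Cons_nth_drop_Suc Suc_lessD append_take_drop_id)
  with i show ?thesis
    by blast
qed

text \<open>The swapped neighbours compare with every other position as before, so only their own
  pair changes.\<close>

lemma inversions_swap: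
  "a < b \<Longrightarrow> inversions (xs @ b # a # ys) = Suc (inversions (xs @ a # b # ys))"
  by (induction xs) auto

lemma inversions_sorted: "sorted u \<Longrightarrow> inversions u = 0"
  by (induction u) (auto simp: filter_empty_conv not_less)

lemma inv_words_pos:
  assumes "n > 0" "dim_seq n d" "k \<le> nu n d"
  shows "inv_words n d (int k) \<ge> 1"
proof -
  have "\<exists>u\<in>words n d. inversions u = k"
    using assms(3)
  proof (induction k)
    case 0
    have "{u \<in> words n d. int (inversions u) = 0} \<noteq> {}"
      using inv_words_0[OF assms(1,2)] unfolding inv_words_def by (metis card.empty zero_neq_one)
    then show ?case
      by auto
  next
    case (Suc k)
    then obtain u where u: "u \<in> words n d" "inversions u = k"
      by auto
    \<comment> \<open>A sorted reversal would have no inversions, which would give \<open>u\<close>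
      all nu(d) of them, more than k.\<close>
    have "\<not> sorted (rev u)"
      using inversions_rev_words[OF assms(1,2) u(1)] inversions_sorted[of "rev u"] u(2) Suc.prems
      by auto
    then obtain xs a b ys where ab: "u = xs @ a # b # ys" "a < b"
      using ex_ascent by blast
    then have "xs @ b # a # ys \<in> words n d"
      using u(1) by (auto simp: words_def)
    then show ?case
      using inversions_swap[OF ab(2)] ab(1) u(2) by blast
  qed
  moreover have "finite (words n d)"
    by (simp add: words_eq_mwords[OF assms(1,2)] finite_mwords)
  ultimately have "card {u \<in> words n d. int (inversions u) = int k} > 0"
    by (auto simp: card_gt_0_iff)
  then show ?thesis
    by (simp add: inv_words_def)
qed

theorem theorem4:
  shows
    "(\<forall>(n::nat) (w::nat list) (r::nat).
        n > 0 \<and> length w = n \<and> (\<forall>x\<in>set w. x > 0) \<longrightarrow>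
        (\<Prod>i=1..r. 1 - fps_X ^ i) / (\<Prod>i<n. 1 - fps_X ^ (w ! i)) =
          (Abs_fps (\<lambda>m. \<Sum>T\<in>Pow {1..r}. (-1) ^ card T * denum w (int m - int (omega T))) :: rat fps))
     \<and>
     (\<forall>(n::nat) (d::nat list) (k::nat).
        n > 0 \<and> dim_seq n d \<longrightarrow>
        of_nat (inv_words n d (int k)) =
          (\<Sum>T\<in>Pow {1..n}. (-1) ^ card T * denum (eps d n) (int k - int (omega T)))
        \<and>
        of_nat (inv_words n d (int k)) =
          (\<Sum>i=0..k. of_int (psi n i) * denum (eps d n) (int k - int i)))
     \<and>
     (\<forall>(n::nat) (k::nat).
        n > 0 \<longrightarrow>
        of_nat (inv_perms n (int k)) =
          (\<Sum>T\<in>Pow {1..n}.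
             (-1) ^ card T * binom (int n - 1 + int k - int (omega T)) (int n - 1))
        \<and>
        of_nat (inv_perms n (int k)) =
          (\<Sum>i=0..k. of_int (psi n i) * binom (int n - 1 + int k - int i) (int n - 1)))
     \<and>
     (\<forall>(n::nat) (d::nat list) (ds::nat list) (k::nat).
        n > 0 \<and> dim_seq n d \<and> refinement n d ds \<longrightarrow>
        int (inv_words n d (int k)) =
          int (inv_words n ds (int k)) -
          (\<Sum>m=1..k.
             (\<Sum>js\<in>tuples (length d + 1) m.
                \<Prod>i=1..length d + 1. int (inv_words (ee n d i) (block n d ds i) (int (js ! (i - 1)))))
             * int (inv_words n d (int k - int m)))
        \<and>
        inv_words n d (int k) \<le> inv_words n ds (int k))
     \<and>
     (\<forall>(n::nat) (d::nat list).
        n > 0 \<and> dim_seq n d \<longrightarrow>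
        (of_nat (nu n d) :: rat) \<le> of_nat n * (of_nat n - 1) / 2 \<and>
        (\<forall>k::nat. inv_words n d (int k) = inv_words n d (int (nu n d) - int k)) \<and>
        (\<forall>k::nat. k \<le> nu n d \<longrightarrow> inv_words n d (int k) \<ge> 1))"
proof (intro conjI allI impI, goal_cases)
  case (1 n w r)
  then show ?case
    using qfact_divide_eq[of w r] by (simp add: qfact_def)
next
  case 2
  then show ?case
    by (intro inv_words_eq_sum_denum) auto
next
  case 3
  then show ?case
    by (intro inv_words_eq_sum_psi) auto
next
  case 4
  then show ?case
    by (rule inv_perms_eq_sum_binom)
next
  case 5
  then show ?case
    by (rule inv_perms_eq_sum_psi)
next
  case 6
  then show ?case
    by (intro inv_words_refinement) auto
next
  case 7
  then show ?case
    by (intro inv_words_le_refinement) auto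
next
  case 8
  then show ?case
    by (intro nu_le) auto
next
  case 9
  then show ?case
    by (intro inv_words_symmetric) auto
next
  case 10
  then show ?case
    by (intro inv_words_pos) auto
qed

end
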